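(* There exist no quartets $(\alpha, n, q, l)$ of integers such that $\alpha > 3$, $q$ is a prime with $q \equiv 1 \bmod 4$, $l$ is a prime, and $2ln^{2} = \sigma(q^{\alpha})$.
   Context: For a positive integer $m$, $\sigma(m)$ denotes the sum of the positive divisors of $m$; thus for $q$ prime and $\alpha \geq 0$, $\sigma(q^{\alpha}) = 1 + q + \cdots + q^{\alpha}$. *)

theory Defs
  imports "HOL-Number_Theory.Number_Theory"
begin

(* Only meaningful for m > 0; for m = 0 the set is infinite and the sum is 0. *)
definition sigma :: "int \<Rightarrow> int" where
  "sigma m = \<Sum>{d. 0 < d \<and> d dvd m}"

lemma sigma_prime_power:
  fixes q :: int
  assumes "prime q"
  shows "sigma (q ^ a) = (\<Sum>i\<le>a. q ^ i)"
proof -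
  have q1: "q > 1" using assms by (rule prime_gt_1_int)
  have "{d. 0 < d \<and> d dvd q ^ a} = (\<lambda>i. q ^ i) ` {..a}"
  proof (intro equalityI subsetI)
    fix d assume d: "d \<in> {d. 0 < d \<and> d dvd q ^ a}"
    then obtain i where "i \<le> a" "normalize d = normalize (q ^ i)"
      using divides_primepow_weak[of q d a] assms by auto
    with d q1 show "d \<in> (\<lambda>i. q ^ i) ` {..a}" by auto
  qed (use q1 in \<open>auto simp: le_imp_power_dvd\<close>)
  moreover have "inj_on (\<lambda>i. q ^ i) {..a}" using q1 by (auto simp: inj_on_def)
  ultimately show ?thesis by (simp add: sigma_def sum.reindex)
qed

end

theory Submission
  imports Defs "HOL-Computational_Algebra.Nth_Powers"
begin

text \<open>
  Write \<open>R k = 1 + q + \<dots> + q^(k-1)\<close>. If \<open>\<sigma>(q^\<alpha>) = 2 l n\<^sup>2\<close> with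
  \<open>q \<equiv> 1 (mod 4)\<close>, parity forces \<open>\<alpha> + 1 = 2 m\<close>, and \<open>\<alpha> > 3\<close> gives \<open>m \<ge> 3\<close>. Then
  \<open>R (2 m) = R m * (q^m + 1)\<close>, so \<open>R m * ((q^m + 1) / 2) = l n\<^sup>2\<close>; the two factors on the
  left are coprime because \<open>(q^m + 1) / 2\<close> is odd and \<open>q^m + 1 = (q - 1) R m + 2\<close>. The prime \<open>l\<close>
  divides one of them, and the other one is a square. Both possibilities are excluded:
  \<open>q^m + 1 = 2 c\<^sup>2\<close> by \<open>prime_power_plus_one_twice_square\<close>, and \<open>R m = a\<^sup>2\<close> by
  \<open>repunit_not_square\<close>.

  Three tools carry these two results.

  \<^item> A Pell-type equation (\<open>pell_prime_power\<close>): \<open>y X\<^sup>2 - (y - 1) Y\<^sup>2 = 1\<close> has no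
    solution in which \<open>\<bar>y\<bar>\<close> and \<open>X > 1\<close> are powers of the same prime \<open>q \<ge> 5\<close>. Its solutions form one
    linear recurrent sequence, and a term that is a power of \<open>q\<close> would have to be smaller than the
    growth of the sequence permits. With \<open>y = q\<close> this says that \<open>R m\<close> is no square for odd \<open>m > 1\<close>;
    with \<open>y = - x\<close>, where \<open>x\<close> is a power of \<open>q\<close>, it says that \<open>(x^p + 1) / (x + 1)\<close> is no square.

  \<^item> Fermat's descent (\<open>fourth_plus_one_not_twice_square\<close>): \<open>z^4 + 1 = 2 b\<^sup>2\<close> is
    impossible for \<open>z > 1\<close>. This settles \<open>q^k + 1 = 2 c\<^sup>2\<close> for exponents divisible by 4.

  \<^item> The Jacobi symbol (\<open>repunit_not_prime_times_square\<close>): if an odd prime \<open>p\<close> divides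
    \<open>k\<close> and \<open>x = q^(k/p)\<close>, then \<open>(x + 1)/2 * ((x^p + 1) / (x + 1)) = c\<^sup>2\<close>, where the greatest
    common divisor of the factors is 1 or \<open>p\<close>. In the first case the second factor is a square and the Pell
    equation applies. In the second case it is \<open>p v\<^sup>2\<close>, and quadratic reciprocity would make every
    integer prime to \<open>p\<close> a quadratic residue modulo \<open>p\<close>.
\<close>

section \<open>A Pell-type equation\<close>

text \<open>
  The terms \<open>X\<close>, \<open>Y\<close> given by
  \<open>X \<surd>y + Y \<surd>(y - 1) = (\<surd>y + \<surd>(y - 1))^(2 n + 1)\<close>. Keeping \<open>y\<close> an arbitrary
  integer lets negative \<open>y\<close> cover the companion equation \<open>(x + 1) Y\<^sup>2 - x X\<^sup>2 = 1\<close>.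
\<close>

fun pell_x pell_y :: "int \<Rightarrow> nat \<Rightarrow> int" where
  "pell_x y 0 = 1"
| "pell_y y 0 = 1"
| "pell_x y (Suc n) = (2 * y - 1) * pell_x y n + 2 * (y - 1) * pell_y y n"
| "pell_y y (Suc n) = 2 * y * pell_x y n + (2 * y - 1) * pell_y y n"

lemma pell_eq: "y * (pell_x y n)\<^sup>2 - (y - 1) * (pell_y y n)\<^sup>2 = 1"
proof (induction n)
  case (Suc n)
  have "y * (pell_x y (Suc n))\<^sup>2 - (y - 1) * (pell_y y (Suc n))\<^sup>2
      = y * (pell_x y n)\<^sup>2 - (y - 1) * (pell_y y n)\<^sup>2"
    by (simp add: power2_eq_square algebra_simps)
  with Suc show ?case by simp
qed simp

lemma pell_x_rec: "pell_x y (Suc (Suc n)) = (4 * y - 2) * pell_x y (Suc n) - pell_x y n"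
  by (simp add: algebra_simps)

text \<open>
  With \<open>\<epsilon> = \<surd>y + \<surd>(y - 1)\<close>, these formulas compare coefficients in
  \<open>\<epsilon>^(2(a+b+1)+1) = \<epsilon>^(2a+1) \<epsilon>^(2b+1) \<epsilon>\<close>.
\<close>
lemma pell_add:
  "pell_x y (Suc (a + b)) = y * pell_x y a * pell_x y b + (y - 1) * pell_y y a * pell_y y b
     + (y - 1) * (pell_x y a * pell_y y b + pell_y y a * pell_x y b)"
  "pell_y y (Suc (a + b)) = y * pell_x y a * pell_x y b + (y - 1) * pell_y y a * pell_y y b
     + y * (pell_x y a * pell_y y b + pell_y y a * pell_x y b)"
proof (induction a)
  case 0
  show "pell_x y (Suc (0 + b)) = y * pell_x y 0 * pell_x y b + (y - 1) * pell_y y 0 * pell_y y b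
     + (y - 1) * (pell_x y 0 * pell_y y b + pell_y y 0 * pell_x y b)"
    "pell_y y (Suc (0 + b)) = y * pell_x y 0 * pell_x y b + (y - 1) * pell_y y 0 * pell_y y b
     + y * (pell_x y 0 * pell_y y b + pell_y y 0 * pell_x y b)"
    by (simp_all add: algebra_simps)
next
  case (Suc a)
  have sx: "pell_x y (Suc (Suc a + b)) = (2 * y - 1) * pell_x y (Suc (a + b)) + 2 * (y - 1) * pell_y y (Suc (a + b))"
   and sy: "pell_y y (Suc (Suc a + b)) = 2 * y * pell_x y (Suc (a + b)) + (2 * y - 1) * pell_y y (Suc (a + b))"
    by (simp_all only: add_Suc pell_x.simps pell_y.simps)
  show "pell_x y (Suc (Suc a + b)) = y * pell_x y (Suc a) * pell_x y b + (y - 1) * pell_y y (Suc a) * pell_y y b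
     + (y - 1) * (pell_x y (Suc a) * pell_y y b + pell_y y (Suc a) * pell_x y b)"
    unfolding sx Suc.IH unfolding pell_x.simps(2) pell_y.simps(2) by (simp add: algebra_simps power2_eq_square)
  show "pell_y y (Suc (Suc a + b)) = y * pell_x y (Suc a) * pell_x y b + (y - 1) * pell_y y (Suc a) * pell_y y b
     + y * (pell_x y (Suc a) * pell_y y b + pell_y y (Suc a) * pell_x y b)"
    unfolding sy Suc.IH unfolding pell_x.simps(2) pell_y.simps(2) by (simp add: algebra_simps power2_eq_square)
qed

text \<open>
  Multiplication of \<open>\<epsilon>^(2a+1)\<close> by the square of
  \<open>\<epsilon>^(2m+1) = X \<surd>y + Y \<surd>(y - 1)\<close>. Modulo \<open>X\<close> the first formula is a mere change of
  sign, which makes \<open>pell_x\<close> a divisibility sequence in the odd index \<open>2 m + 1\<close>.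
\<close>
lemma pell_shift:
  fixes y :: int and m :: nat
  defines "X \<equiv> pell_x y m" and "Y \<equiv> pell_y y m"
  shows "pell_x y (a + Suc (m + m)) = (2 * y * X\<^sup>2 - 1) * pell_x y a + 2 * (y - 1) * X * Y * pell_y y a"
    and "pell_y y (a + Suc (m + m)) = 2 * y * X * Y * pell_x y a + (2 * y * X\<^sup>2 - 1) * pell_y y a"
proof (induction a)
  case 0
  have e: "y * X\<^sup>2 - (y - 1) * Y\<^sup>2 = 1" unfolding X_def Y_def by (rule pell_eq)
  show "pell_x y (0 + Suc (m + m)) = (2 * y * X\<^sup>2 - 1) * pell_x y 0 + 2 * (y - 1) * X * Y * pell_y y 0"
    unfolding add_0_left pell_add X_def[symmetric] Y_def[symmetric] unfolding pell_x.simps(1) pell_y.simps(1) using e by (simp add: algebra_simps power2_eq_square)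
  show "pell_y y (0 + Suc (m + m)) = 2 * y * X * Y * pell_x y 0 + (2 * y * X\<^sup>2 - 1) * pell_y y 0"
    unfolding add_0_left pell_add X_def[symmetric] Y_def[symmetric] unfolding pell_x.simps(1) pell_y.simps(1) using e by (simp add: algebra_simps power2_eq_square)
next
  case (Suc a)
  have sx: "pell_x y (Suc a + Suc (m + m)) = (2 * y - 1) * pell_x y (a + Suc (m + m)) + 2 * (y - 1) * pell_y y (a + Suc (m + m))"
   and sy: "pell_y y (Suc a + Suc (m + m)) = 2 * y * pell_x y (a + Suc (m + m)) + (2 * y - 1) * pell_y y (a + Suc (m + m))"
    by (simp_all only: add_Suc pell_x.simps pell_y.simps)
  show "pell_x y (Suc a + Suc (m + m)) = (2 * y * X\<^sup>2 - 1) * pell_x y (Suc a) + 2 * (y - 1) * X * Y * pell_y y (Suc a)"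
    unfolding sx Suc.IH unfolding pell_x.simps(2) pell_y.simps(2) by (simp add: algebra_simps power2_eq_square)
  show "pell_y y (Suc a + Suc (m + m)) = 2 * y * X * Y * pell_x y (Suc a) + (2 * y * X\<^sup>2 - 1) * pell_y y (Suc a)"
    unfolding sy Suc.IH unfolding pell_x.simps(2) pell_y.simps(2) by (simp add: algebra_simps power2_eq_square)
qed

lemma pell_x_dvd: "pell_x y m dvd pell_x y (m + t * Suc (m + m))"
proof (induction t)
  case (Suc t)
  let ?a = "m + t * Suc (m + m)"
  have "m + Suc t * Suc (m + m) = ?a + Suc (m + m)" by simp
  then have "pell_x y (m + Suc t * Suc (m + m)) = pell_x y (?a + Suc (m + m))" by (rule arg_cong)
  also have "\<dots> =
     pell_x y m * (2 * y * pell_x y m * pell_x y ?a + 2 * (y - 1) * pell_y y m * pell_y y ?a) - pell_x y ?a"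
    unfolding pell_shift(1) by (simp add: algebra_simps power2_eq_square del: pell_x.simps pell_y.simps)
  finally show ?case using Suc by (simp del: pell_x.simps pell_y.simps mult_Suc)
qed simp

text \<open>
  The two lowest terms of \<open>pell_x y n\<close> as a polynomial in \<open>y\<close>; the factor 3 clears the
  denominator of the linear coefficient. The common factor \<open>2 n + 1\<close> is what allows the powers of a
  prime dividing \<open>y\<close> to be counted.
\<close>
lemma pell_x_cong:
  "y\<^sup>2 dvd 3 * pell_x y n - (-1) ^ n * (2 * int n + 1) * (3 - 2 * int n * (int n + 1) * y)"
proof (induction n rule: induct_nat_012)
  case (ge2 n)
  then obtain c0 c1 where
    c0: "3 * pell_x y n = (-1) ^ n * (2 * int n + 1) * (3 - 2 * int n * (int n + 1) * y) + y\<^sup>2 * c0" and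
    c1: "3 * pell_x y (Suc n) = (-1) ^ Suc n * (2 * int (Suc n) + 1) * (3 - 2 * int (Suc n) * (int (Suc n) + 1) * y) + y\<^sup>2 * c1"
    unfolding dvd_def by (metis diff_eq_eq add.commute)
  define N where "N = int n"
  define s where "s = (-1 :: int) ^ n"
  have c0': "3 * pell_x y n = s * (2 * N + 1) * (3 - 2 * N * (N + 1) * y) + y\<^sup>2 * c0"
    using c0 by (simp add: N_def s_def)
  have c1': "3 * pell_x y (Suc n) = - s * (2 * N + 3) * (3 - 2 * (N + 1) * (N + 2) * y) + y\<^sup>2 * c1"
    using c1 unfolding N_def s_def by (simp add: algebra_simps)
  have i2: "int (Suc (Suc n)) = N + 2" "(-1 :: int) ^ Suc (Suc n) = s" by (simp_all add: N_def s_def)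
  have "3 * ((4 * y - 2) * B - A) - s * (2 * (N + 2) + 1) * (3 - 2 * (N + 2) * ((N + 2) + 1) * y)
     = y\<^sup>2 * ((4 * y - 2) * c1 - c0 + 8 * s * (2 * N + 3) * (N + 1) * (N + 2))"
    if "3 * A = s * (2 * N + 1) * (3 - 2 * N * (N + 1) * y) + y\<^sup>2 * c0"
      "3 * B = - s * (2 * N + 3) * (3 - 2 * (N + 1) * (N + 2) * y) + y\<^sup>2 * c1" for A B
  proof -
    have "3 * ((4 * y - 2) * B - A) = (4 * y - 2) * (3 * B) - 3 * A" by (simp add: algebra_simps)
    then show ?thesis unfolding that by (simp add: algebra_simps power2_eq_square)
  qed
  from this[OF c0' c1', folded pell_x_rec]
  have "3 * pell_x y (Suc (Suc n)) - s * (2 * (N + 2) + 1) * (3 - 2 * (N + 2) * ((N + 2) + 1) * y)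
     = y\<^sup>2 * ((4 * y - 2) * c1 - c0 + 8 * s * (2 * N + 3) * (N + 1) * (N + 2))" .
  then show ?case unfolding i2 by (metis dvd_triv_left)
qed (simp_all add: algebra_simps)

lemma pell_x_growth:
  assumes "\<bar>y\<bar> \<ge> 5"
  shows "4 ^ n \<le> \<bar>pell_x y n\<bar>"
proof -
  have step: "4 * \<bar>pell_x y n\<bar> \<le> \<bar>pell_x y (Suc n)\<bar>" for n
  proof (induction n)
    case 0
    show ?case using assms by simp
  next
    case (Suc n)
    have "18 * \<bar>pell_x y (Suc n)\<bar> \<le> \<bar>4 * y - 2\<bar> * \<bar>pell_x y (Suc n)\<bar>"
      using assms by (intro mult_right_mono) auto
    also have "\<dots> = \<bar>(4 * y - 2) * pell_x y (Suc n)\<bar>" by (simp only: abs_mult)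
    also have "\<dots> \<le> \<bar>pell_x y (Suc (Suc n))\<bar> + \<bar>pell_x y n\<bar>"
      unfolding pell_x_rec by linarith
    finally show ?case using Suc by linarith
  qed
  show ?thesis
  proof (induction n)
    case (Suc n)
    then show ?case using step[of n] by (simp del: pell_x.simps)
  qed simp
qed

text \<open>
  Dividing a solution by \<open>\<epsilon>\<^sup>2 = (2 y - 1) + 2 \<surd>(y (y - 1))\<close> makes it smaller. The
  equation itself bounds \<open>Y\<close> between \<open>X\<close> and \<open>y X / (y - 1)\<close>, on the two sides in opposite order for
  positive and for negative \<open>y\<close>.
\<close>
lemma pell_descent:
  fixes X Y y :: int
  assumes eq: "y * X\<^sup>2 - (y - 1) * Y\<^sup>2 = 1" and y: "\<bar>y\<bar> \<ge> 2" and X: "X > 1" and Y: "Y \<ge> 0"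
  shows "\<bar>(2 * y - 1) * X - 2 * (y - 1) * Y\<bar> < X"
proof -
  have sq: "(y * X)\<^sup>2 - ((y - 1) * Y)\<^sup>2 = X\<^sup>2 * y + (y - 1)"
  proof -
    have "(y * X)\<^sup>2 - ((y - 1) * Y)\<^sup>2 = y * (y * X\<^sup>2) - (y - 1) * ((y - 1) * Y\<^sup>2)"
      by (simp add: power2_eq_square)
    also have "(y - 1) * Y\<^sup>2 = y * X\<^sup>2 - 1" using eq by simp
    finally show ?thesis by (simp add: algebra_simps)
  qed
  have sq2: "(y - 1) * (Y\<^sup>2 - X\<^sup>2) = X\<^sup>2 - 1" using eq by (simp add: algebra_simps)
  have X2: "X\<^sup>2 > 1" using X by (simp add: one_less_power)
  show ?thesis
  proof (cases "y > 0")
    case True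
    with y have y2: "y \<ge> 2" by simp
    have "(y - 1) * (Y\<^sup>2 - X\<^sup>2) > 0" using sq2 X2 by simp
    then have "X\<^sup>2 < Y\<^sup>2" using y2 by (simp add: zero_less_mult_iff)
    then have XY: "X < Y" using Y by (rule power2_less_imp_less)
    have "((y - 1) * Y)\<^sup>2 < (y * X)\<^sup>2"
    proof -
      have "X\<^sup>2 * y > 0" using X2 y2 by (intro mult_pos_pos) auto
      then show ?thesis using sq y2 by linarith
    qed
    then have "(y - 1) * Y < y * X" by (rule power2_less_imp_less) (use y2 X in simp)
    moreover have "(y - 1) * X < (y - 1) * Y" using XY y2 by simp
    ultimately show ?thesis by (simp add: abs_less_iff algebra_simps)
  next
    case False
    define x where "x = - y"
    have x2: "x \<ge> 2" using False y by (simp add: x_def)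
    have "(x + 1) * (X\<^sup>2 - Y\<^sup>2) > 0" using sq2 X2 by (simp add: x_def algebra_simps)
    then have "Y\<^sup>2 < X\<^sup>2" using x2 by (simp add: zero_less_mult_iff)
    then have YX: "Y < X" using X by (intro power2_less_imp_less[of Y X]) auto
    have "(x * X)\<^sup>2 < ((x + 1) * Y)\<^sup>2"
    proof -
      have "X\<^sup>2 * x > 0" using X2 x2 by (intro mult_pos_pos) auto
      moreover have "((x + 1) * Y)\<^sup>2 - (x * X)\<^sup>2 = X\<^sup>2 * x + (x + 1)"
        using sq unfolding x_def by (simp add: power2_eq_square algebra_simps)
      ultimately show ?thesis using x2 by linarith
    qed
    then have "x * X < (x + 1) * Y" by (rule power2_less_imp_less) (use x2 Y in simp)
    moreover have "(x + 1) * Y < (x + 1) * X" using YX x2 by simp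
    ultimately have "\<bar>(2 * x + 1) * X - 2 * (x + 1) * Y\<bar> < X" by (simp add: abs_less_iff algebra_simps)
    moreover have "(2 * y - 1) * X - 2 * (y - 1) * Y = - ((2 * x + 1) * X - 2 * (x + 1) * Y)"
      by (simp add: x_def algebra_simps)
    ultimately show ?thesis by simp
  qed
qed

text \<open>
  Descent to the trivial solution \<open>(1, 1)\<close>. The signs of the smaller solution are not under control,
  so undoing the step either advances the sequence or moves it back.
\<close>
lemma pell_solutions:
  fixes X Y y :: int
  assumes "y * X\<^sup>2 - (y - 1) * Y\<^sup>2 = 1" and "\<bar>y\<bar> \<ge> 2" 
  shows "\<exists>n. \<bar>X\<bar> = \<bar>pell_x y n\<bar> \<and> \<bar>Y\<bar> = \<bar>pell_y y n\<bar>"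
proof -
  have nonneg: "\<exists>n. \<bar>X\<bar> = \<bar>pell_x y n\<bar> \<and> \<bar>Y\<bar> = \<bar>pell_y y n\<bar>"
    if "y * X\<^sup>2 - (y - 1) * Y\<^sup>2 = 1" "X \<ge> 0" "Y \<ge> 0" for X Y
    using that
  proof (induction "nat X" arbitrary: X Y rule: less_induct)
    case less
    consider "X = 0" | "X = 1" | "X > 1" using less.prems(2) by linarith
    then show ?case
    proof cases
      case 1
      then have "(1 - y) * Y\<^sup>2 = 1" using less.prems(1) by (simp add: algebra_simps)
      then have "1 - y = 1 \<or> 1 - y = -1" unfolding zmult_eq_1_iff by auto
      then have "y = 2" using assms(2) by auto
      with \<open>(1 - y) * Y\<^sup>2 = 1\<close> have "Y\<^sup>2 = -1" by simp
      moreover have "Y\<^sup>2 \<ge> 0" by simp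
      ultimately show ?thesis by linarith
    next
      case 2
      then have "(y - 1) * (Y\<^sup>2 - 1) = 0" using less.prems(1) by (simp add: algebra_simps)
      then have "Y\<^sup>2 = 1" using assms(2) by auto
      then have "\<bar>Y\<bar> = 1" by (auto simp: power2_eq_1_iff)
      with 2 show ?thesis by (intro exI[of _ 0]) simp
    next
      case 3
      define X' Y' where "X' = (2 * y - 1) * X - 2 * (y - 1) * Y" and "Y' = (2 * y - 1) * Y - 2 * y * X"
      have X: "X = (2 * y - 1) * X' + 2 * (y - 1) * Y'" and Y: "Y = 2 * y * X' + (2 * y - 1) * Y'"
        unfolding X'_def Y'_def by (simp_all add: algebra_simps)
      have eq': "y * X'\<^sup>2 - (y - 1) * Y'\<^sup>2 = 1" using less.prems(1) unfolding X'_def Y'_def by (simp add: power2_eq_square algebra_simps)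
      have "\<bar>X'\<bar> < X" unfolding X'_def using less.prems 3 assms by (intro pell_descent) auto
      then have "nat \<bar>X'\<bar> < nat X" by simp
      from less.hyps[OF this, of "\<bar>Y'\<bar>"] eq'
      obtain n where n: "\<bar>X'\<bar> = \<bar>pell_x y n\<bar>" "\<bar>Y'\<bar> = \<bar>pell_y y n\<bar>" by auto
      define a b where "a = pell_x y n" and "b = pell_y y n"
      have lin: "\<bar>c * X' + d * Y'\<bar> = \<bar>c * a + d * b\<bar>" if "X' = a \<and> Y' = b \<or> X' = - a \<and> Y' = - b" for c d
        using that by (auto simp: abs_minus_commute)
      have lin': "\<bar>c * X' + d * Y'\<bar> = \<bar>c * a - d * b\<bar>" if "X' = a \<and> Y' = - b \<or> X' = - a \<and> Y' = b" for c d
        using that by (auto simp: abs_minus_commute)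
      have "(X' = a \<and> Y' = b \<or> X' = - a \<and> Y' = - b) \<or> (X' = a \<and> Y' = - b \<or> X' = - a \<and> Y' = b)"
        using n unfolding a_def b_def by linarith
      then consider "\<bar>X\<bar> = \<bar>(2 * y - 1) * a + 2 * (y - 1) * b\<bar>" "\<bar>Y\<bar> = \<bar>2 * y * a + (2 * y - 1) * b\<bar>"
        | "\<bar>X\<bar> = \<bar>(2 * y - 1) * a - 2 * (y - 1) * b\<bar>" "\<bar>Y\<bar> = \<bar>2 * y * a - (2 * y - 1) * b\<bar>"
        using lin lin' X Y by metis
      then show ?thesis
      proof cases
        case 1
        then show ?thesis by (intro exI[of _ "Suc n"]) (simp add: a_def b_def)
      next
        case 2
        show ?thesis
        proof (cases n)
          case 0
          \<comment> \<open>The conjugate of the trivial solution is mapped to the trivial solution itself.\<close>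
          then show ?thesis using 2 by (intro exI[of _ 0]) (simp add: a_def b_def)
        next
          case (Suc k)
          have "(2 * y - 1) * a - 2 * (y - 1) * b = pell_x y k"
            "2 * y * a - (2 * y - 1) * b = - pell_y y k"
            unfolding a_def b_def Suc pell_x.simps pell_y.simps by (simp_all add: algebra_simps)
          then show ?thesis using 2 by (intro exI[of _ k]) simp
        qed
      qed
    qed
  qed
  from nonneg[of "\<bar>X\<bar>" "\<bar>Y\<bar>"] assms show ?thesis by simp
qed

text \<open>
  Suppose the \<open>n\<close>-th term of the sequence is a power of \<open>q\<close>. By \<open>pell_x_cong\<close>, \<open>q\<close> divides
  \<open>2 n + 1\<close>, so with \<open>q = 2 h + 1\<close> the \<open>h\<close>-th term divides the \<open>n\<close>-th one and is itself a power of
  \<open>q\<close>. It exceeds \<open>q\<close>, hence is divisible by \<open>q\<^sup>2\<close>; but \<open>pell_x_cong\<close> shows that \<open>q\<close> divides it only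
  once.
\<close>
lemma pell_prime_power:
  fixes q y X Y :: int
  assumes q: "prime q" "q \<ge> 5" and y: "\<bar>y\<bar> = q ^ j" "j > 0"
    and X: "X = q ^ s" "s > 0" and eq: "y * X\<^sup>2 - (y - 1) * Y\<^sup>2 = 1"
  shows False
proof -
  have qy: "q dvd y" using y by (metis dvd_abs_iff dvd_power)
  have "q ^ 1 \<le> q ^ j" using q y(2) by (intro power_increasing) auto
  then have y5: "\<bar>y\<bar> \<ge> 5" using q y by simp
  obtain n where n: "\<bar>pell_x y n\<bar> = q ^ s"
    using pell_solutions[OF eq] y5 X q by (metis abs_of_nonneg order_trans zero_le_numeral zero_le_power
      numeral_le_iff semiring_norm)
  have odd: "odd q" using q prime_odd_int[of q] by auto
  then obtain h0 where h0: "q = 2 * h0 + 1" by (rule oddE)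
  define h where "h = nat h0"
  have h: "q = 2 * int h + 1" "h > 0" using h0 q by (auto simp: h_def)
  have q3: "\<not> q dvd 3" using q zdvd_imp_le[of q 3] by auto
  have qcong: "q dvd 2 * int n + 1"
  proof -
    have "q dvd 3 * pell_x y n" using n X(2) by (metis dvd_abs_iff dvd_mult dvd_power)
    moreover have "q dvd y\<^sup>2" using qy by (simp add: power2_eq_square)
    from dvd_trans[OF this pell_x_cong[of y n]]
    have "q dvd 3 * pell_x y n - (-1) ^ n * (2 * int n + 1) * (3 - 2 * int n * (int n + 1) * y)" .
    ultimately have "q dvd (-1) ^ n * (2 * int n + 1) * (3 - 2 * int n * (int n + 1) * y)"
      by (metis dvd_diff add_diff_cancel_left' diff_add_cancel)
    moreover have "\<not> q dvd 3 - 2 * int n * (int n + 1) * y"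
      using q3 qy by (metis dvd_mult dvd_diff_right_iff dvd_diff_commute)
    moreover have "\<not> q dvd (-1) ^ n"
      using q(1) by (cases "even n") (auto simp: not_prime_unit)
    ultimately show ?thesis using q(1) by (auto simp: prime_dvd_mult_iff)
  qed
  obtain t where t: "n = h + t * Suc (h + h)"
  proof -
    from qcong obtain k where k: "2 * int n + 1 = q * k" by (elim dvdE)
    have "k > 0" using k q by (smt (verit) mult_nonneg_nonpos of_nat_0_le_iff)
    moreover have "odd k" using k by (metis even_mult_iff odd_two_times_div_two_succ dvd_triv_left even_plus_one_iff)
    ultimately obtain t0 where t0: "k = 2 * t0 + 1" "t0 \<ge> 0" by (elim oddE) auto
    have "int n = int (h + nat t0 * Suc (h + h))" using k h t0 by (simp add: algebra_simps)
    then show thesis using that of_nat_eq_iff by blast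
  qed
  have "pell_x y h dvd q ^ s" using pell_x_dvd[of y h t] n t by (metis dvd_abs_iff)
  then obtain e where e: "\<bar>pell_x y h\<bar> = q ^ e"
    using divides_primepow_weak[OF q(1)] q(1) by (metis abs_of_nonneg normalize_int_def q(1) divides_primepow_weak prime_ge_0_int zero_le_power)
  have "2 * int h + 1 < 4 ^ h"
    using h(2)
  proof (induction h rule: nat_induct_non_zero)
    case (Suc n)
    then show ?case by (simp add: algebra_simps)
  qed simp
  then have "q < q ^ e" using pell_x_growth[OF y5, of h] e h by linarith
  then have "e > 1" using q by (metis less_irrefl nat_neq_iff less_one power_0 power_one_right One_nat_def not_less prime_gt_1_int power_strict_increasing_iff)
  then have "q\<^sup>2 dvd q ^ e" by (intro le_imp_power_dvd) simp
  then have "q\<^sup>2 dvd 3 * pell_x y h" using e by (metis dvd_abs_iff dvd_mult)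
  moreover have "q\<^sup>2 dvd y\<^sup>2" using qy by (rule dvd_power_same)
  from dvd_trans[OF this pell_x_cong[of y h]]
  have "q\<^sup>2 dvd 3 * pell_x y h - (-1) ^ h * q * (3 - 2 * int h * (int h + 1) * y)" by (simp add: h)
  ultimately have "q\<^sup>2 dvd (-1) ^ h * q * (3 - 2 * int h * (int h + 1) * y)"
    by (metis dvd_diff add_diff_cancel_left' diff_add_cancel)
  then have "q * q dvd q * (3 - 2 * int h * (int h + 1) * y)"
    by (cases "even h") (auto simp: power2_eq_square)
  then have "q dvd 3 - 2 * int h * (int h + 1) * y" using q by simp
  then show False using q3 qy by (metis dvd_mult dvd_diff_right_iff dvd_diff_commute)
qed


section \<open>Fermat's descent for \<open>z^4 + 1 = 2 b\<^sup>2\<close>\<close>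

lemma coprime_mult_square:
  fixes a b c :: int
  assumes "coprime a b" "a * b = c\<^sup>2" "a > 0" "b > 0"
  shows "\<exists>d > 0. a = d\<^sup>2"
proof -
  have "coprime (nat a) (nat b)" using assms by (simp add: coprime_int_iff[symmetric])
  moreover have "is_nth_power 2 (nat a * nat b)"
  proof (rule is_nth_powerI)
    have "int (nat a * nat b) = int ((nat \<bar>c\<bar>)\<^sup>2)" using assms by simp
    then show "nat a * nat b = (nat \<bar>c\<bar>)\<^sup>2" by (simp only: of_nat_eq_iff)
  qed
  ultimately have "is_nth_power 2 (nat a)"
    using assms is_nth_power_mult_coprime_natD(1)[of "nat a" "nat b" 2] by auto
  then obtain d where d: "nat a = d\<^sup>2" by (rule is_nth_powerE)
  then have "int (nat a) = (int d)\<^sup>2" by simp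
  then have "a = (int d)\<^sup>2" using assms by simp
  moreover have "int d > 0" using calculation assms by (cases d) auto
  ultimately show ?thesis by blast
qed

lemma pythagorean_param:
  fixes a b c :: int
  assumes eq: "a\<^sup>2 + b\<^sup>2 = c\<^sup>2" and cop: "coprime a b" and a: "odd a" "a > 0"
    and b: "b > 0" and c: "c > 0"
  shows "\<exists>r s. r > s \<and> s > 0 \<and> coprime r s \<and> a = r\<^sup>2 - s\<^sup>2 \<and> b = 2 * r * s \<and> c = r\<^sup>2 + s\<^sup>2"
proof -
  have "even b"
  proof (rule ccontr)
    assume ob: "odd b"
    obtain i j where ij: "a = 2 * i + 1" "b = 2 * j + 1" using a ob by (metis oddE)
    have "c\<^sup>2 = 4 * (i\<^sup>2 + i + j\<^sup>2 + j) + 2" using eq unfolding ij by (simp add: power2_eq_square algebra_simps)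
    moreover have "even c" using calculation by (metis even_add even_mult_iff even_numeral even_power dvd_mult2 dvd_triv_left even_plus_one_iff numeral_Bit0)
    then obtain k where "c = 2 * k" by (elim evenE)
    ultimately have "4 * k\<^sup>2 = 4 * (i\<^sup>2 + i + j\<^sup>2 + j) + 2" by (simp add: power_mult_distrib)
    then show False by presburger
  qed
  have "odd c" using eq a \<open>even b\<close> by (metis even_add even_power pos2)
  have bc: "coprime b c"
  proof (rule coprimeI)
    fix d assume "d dvd b" "d dvd c"
    then have "d\<^sup>2 dvd c\<^sup>2 - b\<^sup>2" by (intro dvd_diff dvd_power_same)
    then have "d\<^sup>2 dvd a\<^sup>2" using eq by (metis add_diff_cancel_right')
    then have "d dvd a" by simp
    then show "is_unit d" using \<open>d dvd b\<close> cop coprime_common_divisor by blast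
  qed
  have cb: "c > b" using eq a c by (smt (verit) power2_less_imp_less zero_less_power)
  have fac: "(c + b) * (c - b) = a\<^sup>2" using eq by (simp add: power2_eq_square algebra_simps)
  have cop2: "coprime (c + b) (c - b)"
  proof (rule coprimeI)
    fix d assume d: "d dvd c + b" "d dvd c - b"
    then have "d dvd a\<^sup>2" using fac by (metis dvd_mult2)
    then have "odd d" using a by (metis dvd_trans even_power)
    have "d dvd (c + b) + (c - b)" "d dvd (c + b) - (c - b)" using d by (rule dvd_add, rule dvd_diff)
    then have "d dvd 2 * c" "d dvd 2 * b" by simp_all
    moreover have "coprime d 2" using \<open>odd d\<close> by simp
    ultimately have "d dvd c" "d dvd b" by (simp_all add: coprime_dvd_mult_right_iff)
    then show "is_unit d" using bc coprime_common_divisor by blast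
  qed
  obtain g where g: "g > 0" "c + b = g\<^sup>2" using coprime_mult_square[OF cop2 fac] cb b c by auto
  obtain h where h: "h > 0" "c - b = h\<^sup>2"
    using coprime_mult_square[of "c - b" "c + b" a] cop2 fac cb b c by (auto simp: coprime_commute mult.commute)
  have "odd g" "odd h" using g h \<open>even b\<close> \<open>odd c\<close> by (metis even_add even_diff even_power pos2)+
  have "h < g" using g h b by (intro power2_less_imp_less[of h g]) auto
  define r s where "r = (g + h) div 2" and "s = (g - h) div 2"
  have gr: "g = r + s" and hr: "h = r - s" using \<open>odd g\<close> \<open>odd h\<close> unfolding r_def s_def by presburger+
  have "a\<^sup>2 = (g * h)\<^sup>2" using fac g h by (simp add: power_mult_distrib)
  then have agh: "a = g * h" using a g h by (simp add: power2_eq_iff_nonneg)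
  have "2 * b = 4 * r * s" "2 * c = 2 * (r\<^sup>2 + s\<^sup>2)" using g h unfolding gr hr by (simp_all add: power2_eq_square algebra_simps)
  then have b': "b = 2 * r * s" and c': "c = r\<^sup>2 + s\<^sup>2" by simp_all
  have "coprime r s"
  proof (rule coprimeI)
    fix d assume d: "d dvd r" "d dvd s"
    have "d dvd b" "d dvd c" using d unfolding b' c' by (simp_all add: power2_eq_square)
    then show "is_unit d" using bc coprime_common_divisor by blast
  qed
  moreover have "a = r\<^sup>2 - s\<^sup>2" using agh unfolding gr hr by (simp add: power2_eq_square algebra_simps)
  moreover have "s > 0" using \<open>h < g\<close> gr hr by linarith
  moreover have "r > s" using h hr by linarith
  ultimately show ?thesis using b' c' by blast
qed

text \<open>
  Half of the descent step. The leg \<open>j\<^sup>2 = 2 r s\<close> of a primitive Pythagorean triple makes one of \<open>r\<close>,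
  \<open>s\<close> a square and the other twice a square; these enter the formula for the hypotenuse \<open>i\<^sup>2\<close>.
\<close>
lemma fourth_power_difference_square:
  fixes e i j :: int
  assumes eq: "e\<^sup>2 + (j\<^sup>2)\<^sup>2 = (i\<^sup>2)\<^sup>2" and cop: "coprime e j"
    and e: "odd e" "e > 0" and j: "j > 0" and i: "i > 0"
  shows "\<exists>e' f'. i\<^sup>2 = e' ^ 4 + 4 * f' ^ 4 \<and> odd e' \<and> e' > 0 \<and> f' > 0 \<and> coprime e' f'"
proof -
  have "coprime e (j\<^sup>2)" using cop by simp
  then obtain r s where rs: "r > s" "s > 0" "coprime r s" "e = r\<^sup>2 - s\<^sup>2" "j\<^sup>2 = 2 * r * s" "i\<^sup>2 = r\<^sup>2 + s\<^sup>2"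
    using pythagorean_param[OF eq] e i j by auto
  have main: ?thesis if uv: "coprime u v" "u > 0" "v > 0" "odd u" "even v" "j\<^sup>2 = 2 * u * v" "i\<^sup>2 = u\<^sup>2 + v\<^sup>2" for u v
  proof -
    obtain w where w: "v = 2 * w" using uv by (elim evenE)
    have "even j" using uv(6) by (metis even_mult_iff even_numeral even_power)
    then obtain k where k: "j = 2 * k" by (elim evenE)
    have uw: "u * w = k\<^sup>2" using uv(6) unfolding w k by (simp add: power_mult_distrib)
    have cop': "coprime u w" using uv w by simp
    obtain e' where e': "e' > 0" "u = e'\<^sup>2" using coprime_mult_square[OF cop' uw] uv w by auto
    obtain f' where f': "f' > 0" "w = f'\<^sup>2" using coprime_mult_square[of w u k] cop' uw uv w
      by (auto simp: coprime_commute mult.commute)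
    have "i\<^sup>2 = e' ^ 4 + 4 * f' ^ 4"
      using uv(7) unfolding w e'(2) f'(2) by (simp add: power_mult_distrib flip: power_mult)
    moreover have "odd e'" "coprime e' f'" using uv(4) cop' e' f' by auto
    ultimately show ?thesis using e' f' by blast
  qed
  have "odd r \<noteq> odd s" using rs(4) e by auto
  then show ?thesis
    using main[of r s] main[of s r] rs by (auto simp: coprime_commute mult.commute add.commute)
qed

text \<open>
  The other half: in the triple \<open>(e\<^sup>2, 2 f\<^sup>2, x)\<close> the parameters \<open>r\<close>, \<open>s\<close> have square product and
  hence are squares \<open>i\<^sup>2\<close>, \<open>j\<^sup>2\<close>, so that \<open>e\<^sup>2 = i^4 - j^4\<close>. The previous lemma then expresses
  \<open>i\<^sup>2\<close> in the same form as \<open>x\<^sup>2\<close>, with \<open>i < x\<close>.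
\<close>
lemma no_fourth_plus_four_fourth:
  fixes e f x :: int
  assumes "x\<^sup>2 = e ^ 4 + 4 * f ^ 4" "odd e" "e > 0" "f > 0" "x > 0" "coprime e f"
  shows False
  using assms
proof (induction "nat x" arbitrary: x e f rule: less_induct)
  case less
  have cop: "coprime (e\<^sup>2) (2 * f\<^sup>2)" using less.prems by simp
  have "(e\<^sup>2)\<^sup>2 + (2 * f\<^sup>2)\<^sup>2 = x\<^sup>2" using less.prems(1) by (simp add: power_mult_distrib flip: power_mult)
  from pythagorean_param[OF this cop] less.prems
  obtain r s where rs: "r > s" "s > 0" "coprime r s" "e\<^sup>2 = r\<^sup>2 - s\<^sup>2" "2 * f\<^sup>2 = 2 * r * s" "x = r\<^sup>2 + s\<^sup>2"
    by auto
  have f: "r * s = f\<^sup>2" using rs by simp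
  obtain i where i: "i > 0" "r = i\<^sup>2" using coprime_mult_square[OF rs(3) f] rs by auto
  obtain j where j: "j > 0" "s = j\<^sup>2" using coprime_mult_square[of s r f] rs f by (auto simp: coprime_commute mult.commute)
  have "coprime e j"
  proof (rule coprimeI)
    fix d assume d: "d dvd e" "d dvd j"
    then have ds: "d dvd s" using j by (simp add: power2_eq_square)
    have "d\<^sup>2 dvd e\<^sup>2 + s\<^sup>2" using d ds by (intro dvd_add dvd_power_same)
    then have "d\<^sup>2 dvd r\<^sup>2" using rs by simp
    then have "d dvd r" by simp
    then show "is_unit d" using ds rs(3) coprime_common_divisor by blast
  qed
  moreover have "e\<^sup>2 + (j\<^sup>2)\<^sup>2 = (i\<^sup>2)\<^sup>2" using rs i j by simp
  ultimately obtain e' f' where ef: "i\<^sup>2 = e' ^ 4 + 4 * f' ^ 4" "odd e'" "e' > 0" "f' > 0" "coprime e' f'"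
    using fourth_power_difference_square less.prems i j by meson
  have "i \<le> r" using i by (simp add: power2_eq_square)
  also have "r \<le> r\<^sup>2" using rs by (simp add: power2_eq_square)
  also have "r\<^sup>2 < x" using rs by simp
  finally have "nat i < nat x" using i by simp
  then show False using less.hyps[of i e' f'] ef i by blast
qed

text \<open>
  With \<open>z\<^sup>2 = 2 h + 1\<close> the equation reads \<open>b\<^sup>2 = (h + 1)\<^sup>2 + h\<^sup>2\<close>, while \<open>z\<^sup>2 = (h + 1)\<^sup>2 - h\<^sup>2\<close>. The
  product of the two says that \<open>(h + 1)^4 - h^4\<close> is a square, which starts the descent.
\<close>
lemma fourth_plus_one_not_twice_square:
  fixes z b :: int
  assumes "z ^ 4 + 1 = 2 * b\<^sup>2" "z > 1"
  shows False
proof -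
  have "odd z" using assms by (metis even_add even_mult_iff even_numeral even_power odd_one zero_less_numeral)
  then obtain h where h: "z\<^sup>2 = 2 * h + 1" by (metis even_power oddE pos2)
  have z2: "z\<^sup>2 > 1" using assms(2) by (simp add: one_less_power)
  have h0: "h > 0" using z2 h by linarith
  have b2: "b\<^sup>2 = (h + 1)\<^sup>2 + h\<^sup>2"
  proof -
    have "z ^ 4 = (z\<^sup>2)\<^sup>2" by (simp flip: power_mult)
    then show ?thesis using assms(1) unfolding h by (simp add: power2_eq_square algebra_simps)
  qed
  have b0: "b \<noteq> 0" using b2 h0 by (smt (verit) zero_less_power zero_eq_power2)
  have e0: "even h"
  proof -
    obtain k where "z = 2 * k + 1" using \<open>odd z\<close> by (rule oddE)
    then have "2 * h = 2 * (2 * (k * (k + 1)))" using h by (simp add: power2_eq_square algebra_simps)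
    then show ?thesis by simp
  qed
  define w where "w = \<bar>b\<bar> * z"
  have w2: "w\<^sup>2 = ((h + 1)\<^sup>2 + h\<^sup>2) * ((h + 1)\<^sup>2 - h\<^sup>2)"
    unfolding w_def power_mult_distrib power2_abs b2 h by (simp add: power2_eq_square algebra_simps)
  then have eq: "w\<^sup>2 + (h\<^sup>2)\<^sup>2 = ((h + 1)\<^sup>2)\<^sup>2" by (simp add: power2_eq_square algebra_simps)
  have "coprime w h"
  proof (rule coprimeI)
    fix d assume d: "d dvd w" "d dvd h"
    then have dh: "d dvd h\<^sup>2" by (simp add: power2_eq_square)
    have "d\<^sup>2 dvd w\<^sup>2 + (h\<^sup>2)\<^sup>2" using d dh by (intro dvd_add dvd_power_same)
    then have "d\<^sup>2 dvd ((h + 1)\<^sup>2)\<^sup>2" by (simp only: eq)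
    then have "d dvd (h + 1)\<^sup>2" by (subst (asm) pow_divides_pow_iff) auto
    then have "d dvd (h + 1)\<^sup>2 - h * (h + 2)" using d by (intro dvd_diff dvd_mult2)
    then show "is_unit d" by (simp add: power2_eq_square algebra_simps)
  qed
  moreover have "odd w" using eq e0 by (metis even_add even_power odd_one pos2)
  moreover have "w > 0" using b0 assms(2) by (simp add: w_def)
  ultimately obtain e f where "(h + 1)\<^sup>2 = e ^ 4 + 4 * f ^ 4" "odd e" "e > 0" "f > 0" "coprime e f"
    using fourth_power_difference_square[OF eq] h0 by auto
  then show False using no_fourth_plus_four_fourth[of "h + 1" e f] h0 by auto
qed

section \<open>The Jacobi symbol\<close>

lemma Legendre_values: "Legendre a p \<in> {-1, 0, 1}"
  by (simp add: Legendre_def)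

lemma Legendre_cong:
  assumes "[a = b] (mod p)"
  shows "Legendre a p = Legendre b p"
proof -
  have "[a = 0] (mod p) \<longleftrightarrow> [b = 0] (mod p)" using assms by (metis cong_sym cong_trans)
  moreover have "QuadRes p a \<longleftrightarrow> QuadRes p b" unfolding QuadRes_def using assms by (metis cong_sym cong_trans)
  ultimately show ?thesis by (simp add: Legendre_def)
qed

lemma cong_sign_eq:
  fixes a b p :: int
  assumes "[a = b] (mod p)" "p > 2" "a \<in> {-1, 0, 1}" "b \<in> {-1, 0, 1}"
  shows "a = b"
proof (rule ccontr)
  assume "a \<noteq> b"
  moreover have "p dvd a - b" using assms(1) by (simp add: cong_iff_dvd_diff)
  ultimately have "\<bar>p\<bar> \<le> \<bar>a - b\<bar>" by (intro dvd_imp_le_int) auto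
  then show False using assms by auto
qed

lemma euler_criterion_int:
  fixes p :: int
  assumes "prime p" "p > 2"
  shows "[Legendre a p = a ^ nat ((p - 1) div 2)] (mod p)"
proof -
  have "prime (nat p)" "2 < nat p" using assms by (simp_all add: prime_nat_iff_prime)
  from euler_criterion[OF this, of a]
  have "[Legendre a p = a ^ ((nat p - 1) div 2)] (mod p)" using assms by simp
  also have "(nat p - 1) div 2 = nat ((p - 1) div 2)" using assms by linarith
  finally show ?thesis .
qed

lemma Legendre_mult:
  fixes p :: int
  assumes "prime p" "p > 2"
  shows "Legendre (a * b) p = Legendre a p * Legendre b p"
proof (rule cong_sign_eq)
  have "[Legendre (a * b) p = (a * b) ^ nat ((p - 1) div 2)] (mod p)"
    by (rule euler_criterion_int[OF assms])
  moreover have "[Legendre a p * Legendre b p = a ^ nat ((p - 1) div 2) * b ^ nat ((p - 1) div 2)] (mod p)"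
    by (intro cong_mult euler_criterion_int assms)
  ultimately show "[Legendre (a * b) p = Legendre a p * Legendre b p] (mod p)"
    by (metis cong_sym cong_trans power_mult_distrib)
  show "Legendre a p * Legendre b p \<in> {- 1, 0, 1}"
    using Legendre_values[of a p] Legendre_values[of b p] by auto
qed (use assms Legendre_values in auto)

text \<open>
  For odd arguments this is \<open>(-1)^((m-1)/2 * (n-1)/2)\<close>, in a form whose multiplicativity is a case
  distinction modulo 4.
\<close>
definition reciprocity_sign :: "int \<Rightarrow> int \<Rightarrow> int" where
  "reciprocity_sign m n = (if m mod 4 = 3 \<and> n mod 4 = 3 then -1 else 1)"

lemma odd_mult_mod_4:
  fixes a b :: int
  assumes "odd a" "odd b"
  shows "(a * b) mod 4 = (if a mod 4 = b mod 4 then 1 else 3)"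
proof -
  have a: "a mod 4 = 1 \<or> a mod 4 = 3" using assms(1) by presburger
  have b: "b mod 4 = 1 \<or> b mod 4 = 3" using assms(2) by presburger
  have "(a * b) mod 4 = (a mod 4) * (b mod 4) mod 4" by (simp add: mod_mult_eq)
  with a b show ?thesis by auto
qed

lemma reciprocity_sign_mult:
  assumes "odd a" "odd b" "odd n"
  shows "reciprocity_sign (a * b) n = reciprocity_sign a n * reciprocity_sign b n"
    and "reciprocity_sign n (a * b) = reciprocity_sign n a * reciprocity_sign n b"
proof -
  have a: "a mod 4 = 1 \<or> a mod 4 = 3" using assms(1) by presburger
  have b: "b mod 4 = 1 \<or> b mod 4 = 3" using assms(2) by presburger
  show "reciprocity_sign (a * b) n = reciprocity_sign a n * reciprocity_sign b n"
    and "reciprocity_sign n (a * b) = reciprocity_sign n a * reciprocity_sign n b"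
    using a b unfolding reciprocity_sign_def odd_mult_mod_4[OF assms(1,2)] by auto
qed

lemma Legendre_reciprocity:
  fixes p q :: int
  assumes "prime p" "p > 2" "prime q" "q > 2"
  shows "Legendre p q = reciprocity_sign p q * Legendre q p"
proof (cases "p = q")
  case True
  then show ?thesis by (simp add: Legendre_def cong_def)
next
  case False
  have nd: "\<not> [p = 0] (mod q)" "\<not> [q = 0] (mod p)"
    using False assms primes_dvd_imp_eq[of p q] primes_dvd_imp_eq[of q p] by (auto simp: cong_0_iff)
  have odd: "odd p" "odd q" using assms prime_odd_int by auto
  have "Legendre p q * Legendre q p = (-1) ^ nat ((p - 1) div 2 * ((q - 1) div 2))"
    using assms False by (intro Quadratic_Reciprocity_int) (simp_all add: prime_nat_iff_prime)
  also have "\<dots> = reciprocity_sign p q"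
  proof -
    have "p mod 4 = 1 \<or> p mod 4 = 3" "q mod 4 = 1 \<or> q mod 4 = 3" using odd by presburger+
    moreover have "even ((p - 1) div 2) \<longleftrightarrow> p mod 4 = 1" "even ((q - 1) div 2) \<longleftrightarrow> q mod 4 = 1"
      using odd by presburger+
    moreover have "(p - 1) div 2 * ((q - 1) div 2) \<ge> 0" using assms by simp
    ultimately show ?thesis
      by (auto simp: reciprocity_sign_def minus_one_power_iff even_nat_iff)
  qed
  finally have *: "Legendre p q * Legendre q p = reciprocity_sign p q" .
  have "Legendre q p = 1 \<or> Legendre q p = -1" using nd by (simp add: Legendre_def)
  then show ?thesis using * by auto
qed

text \<open>The product over a multiset counts each prime divisor with its multiplicity.\<close>
definition jacobi :: "int \<Rightarrow> int \<Rightarrow> int" where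
  "jacobi a n = (\<Prod>p\<in>#prime_factorization n. Legendre a p)"

lemma jacobi_1_right [simp]: "jacobi a 1 = 1"
  by (simp add: jacobi_def)

lemma jacobi_prime: "prime p \<Longrightarrow> jacobi a p = Legendre a p"
  by (simp add: jacobi_def prime_factorization_prime)

lemma jacobi_mult_right: "m \<noteq> 0 \<Longrightarrow> n \<noteq> 0 \<Longrightarrow> jacobi a (m * n) = jacobi a m * jacobi a n"
  by (simp add: jacobi_def prime_factorization_mult)

lemma jacobi_cong:
  assumes "[a = b] (mod n)"
  shows "jacobi a n = jacobi b n"
proof -
  have "Legendre a p = Legendre b p" if "p \<in># prime_factorization n" for p
    using that assms by (intro Legendre_cong) (auto intro: cong_dvd_modulus in_prime_factors_imp_dvd)
  then show ?thesis unfolding jacobi_def by (metis image_mset_cong)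
qed

lemma odd_positive_induct [consumes 2, case_names one prime_factor]:
  fixes n :: int
  assumes "odd n" "n > 0" and one: "P 1"
    and step: "\<And>p m. prime p \<Longrightarrow> p > 2 \<Longrightarrow> odd p \<Longrightarrow> odd m \<Longrightarrow> m > 0 \<Longrightarrow> P m \<Longrightarrow> P (p * m)"
  shows "P n"
  using assms(1,2)
proof (induction n rule: prime_divisors_induct)
  case (unit x)
  then show ?case using one by auto
next
  case (factor p x)
  then have "odd p" "odd x" by auto
  moreover have "p > 0" using factor prime_gt_0_int by blast
  moreover have "x > 0" using factor \<open>p > 0\<close> by (simp add: zero_less_mult_iff)
  moreover have "p > 2" using \<open>odd p\<close> factor(1) prime_ge_2_int[of p] by (cases "p = 2") auto
  ultimately show ?case using factor step by blast
qed simp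

lemma jacobi_mult_left:
  assumes "odd n" "n > 0"
  shows "jacobi (a * b) n = jacobi a n * jacobi b n"
  using assms
  by (induction n rule: odd_positive_induct) (simp_all add: jacobi_mult_right jacobi_prime Legendre_mult)

lemma jacobi_1_left: "odd n \<Longrightarrow> n > 0 \<Longrightarrow> jacobi 1 n = 1"
proof (induction n rule: odd_positive_induct)
  case (prime_factor p m)
  have "QuadRes p 1" unfolding QuadRes_def by (intro exI[of _ 1]) simp
  then have "Legendre 1 p = 1" using prime_factor(1) by (auto simp: Legendre_def cong_0_iff not_prime_unit)
  then show ?case using prime_factor by (simp add: jacobi_mult_right jacobi_prime)
qed simp

lemma jacobi_power_left:
  assumes "odd n" "n > 0"
  shows "jacobi (a ^ k) n = jacobi a n ^ k"
  by (induction k) (simp_all add: assms jacobi_1_left jacobi_mult_left)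

lemma jacobi_reciprocity:
  assumes "odd m" "m > 0" "odd n" "n > 0"
  shows "jacobi m n = reciprocity_sign m n * jacobi n m"
proof -
  have prime: "jacobi p n = reciprocity_sign p n * jacobi n p" if p: "prime p" "p > 2" "odd p" for p
    using assms(3,4)
  proof (induction n rule: odd_positive_induct)
    case one
    then show ?case using p by (simp add: jacobi_1_left reciprocity_sign_def)
  next
    case (prime_factor r n)
    then show ?case using p
      by (simp add: jacobi_mult_right jacobi_mult_left jacobi_prime[of r] Legendre_reciprocity[of p r]
           reciprocity_sign_mult(2) jacobi_prime[of p] Legendre_mult)
  qed
  show ?thesis using assms(1,2)
  proof (induction m rule: odd_positive_induct)
    case one
    then show ?case using assms by (simp add: jacobi_1_left reciprocity_sign_def)
  next
    case (prime_factor p m)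
    then show ?case using assms prime[of p]
      by (simp add: jacobi_mult_right jacobi_mult_left reciprocity_sign_mult(1))
  qed
qed

lemma jacobi_reciprocity_1_mod_4:
  assumes "odd m" "m > 0" "n > 0" "n mod 4 = 1"
  shows "jacobi m n = jacobi n m"
proof -
  have "odd n" using assms(4) by presburger
  then show ?thesis using assms jacobi_reciprocity[of m n] by (simp add: reciprocity_sign_def)
qed

lemma jacobi_minus_1: "n > 0 \<Longrightarrow> n mod 4 = 1 \<Longrightarrow> jacobi (-1) n = 1"
proof -
  have gen: "jacobi (-1) n = (if n mod 4 = 1 then 1 else -1)" if "odd n" "n > 0"
    using that
  proof (induction n rule: odd_positive_induct)
    case (prime_factor p m)
    have "Legendre (-1) p = (-1) ^ nat ((p - 1) div 2)"
      by (rule cong_sign_eq[OF euler_criterion_int[of p "-1"]])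
         (use prime_factor Legendre_values in \<open>auto simp: minus_one_power_iff\<close>)
    moreover have "even (nat ((p - 1) div 2)) \<longleftrightarrow> p mod 4 = 1"
    proof -
      have "even (nat ((p - 1) div 2)) \<longleftrightarrow> even ((p - 1) div 2)" using \<open>p > 2\<close> by (simp add: even_nat_iff)
      also have "even ((p - 1) div 2) \<longleftrightarrow> p mod 4 = 1" using \<open>odd p\<close> by presburger
      finally show ?thesis .
    qed
    ultimately have "Legendre (-1) p = (if p mod 4 = 1 then 1 else -1)" by (simp add: minus_one_power_iff)
    moreover have "p mod 4 = 1 \<or> p mod 4 = 3" using \<open>odd p\<close> by presburger
    moreover have "m mod 4 = 1 \<or> m mod 4 = 3" using \<open>odd m\<close> by presburger
    ultimately show ?case using prime_factor odd_mult_mod_4[of p m]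
      by (auto simp: jacobi_mult_right jacobi_prime)
  qed simp
  assume n: "n > 0" "n mod 4 = 1"
  moreover from n(2) have "odd n" by presburger
  ultimately show ?thesis using gen by simp
qed

text \<open>
  Otherwise squaring would be surjective, hence injective, on the nonzero residues; but \<open>1\<close> and \<open>-1\<close>
  have the same square.
\<close>
lemma quadratic_nonresidue_exists:
  fixes p :: int
  assumes "prime p" "p > 2"
  shows "\<exists>a > 0. Legendre a p = -1"
proof (rule ccontr)
  assume "\<not> ?thesis"
  then have res: "QuadRes p a" if "a > 0" "\<not> p dvd a" for a
    using that by (auto simp: Legendre_def cong_0_iff split: if_splits)
  let ?A = "{1..p - 1}"
  have inA: "y\<^sup>2 mod p \<in> ?A" if "\<not> p dvd y" for y
  proof -
    have "\<not> p dvd y\<^sup>2" using that assms(1) prime_dvd_power by blast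
    then have "y\<^sup>2 mod p \<noteq> 0" by (simp add: dvd_eq_mod_eq_0)
    moreover have "0 \<le> y\<^sup>2 mod p" "y\<^sup>2 mod p < p" using assms by simp_all
    ultimately show ?thesis by simp
  qed
  have "?A \<subseteq> (\<lambda>y. y\<^sup>2 mod p) ` ?A"
  proof
    fix a assume a: "a \<in> ?A"
    then have nd: "\<not> p dvd a" using zdvd_not_zless by auto
    then obtain y where y: "[y\<^sup>2 = a] (mod p)" using res[of a] a by (auto simp: QuadRes_def)
    have "\<not> p dvd y"
    proof
      assume "p dvd y"
      then have "p dvd y\<^sup>2" by (simp add: power2_eq_square)
      then show False using y nd cong_dvd_iff by blast
    qed
    then have "y mod p \<noteq> 0" by (simp add: dvd_eq_mod_eq_0)
    moreover have "0 \<le> y mod p" "y mod p < p" using assms by simp_all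
    ultimately have "y mod p \<in> ?A" by simp
    moreover have "(y mod p)\<^sup>2 mod p = a" using y a by (simp add: power_mod cong_def)
    ultimately show "a \<in> (\<lambda>y. y\<^sup>2 mod p) ` ?A" by force
  qed
  then have "card ((\<lambda>y. y\<^sup>2 mod p) ` ?A) \<ge> card ?A" by (intro card_mono) auto
  then have "inj_on (\<lambda>y. y\<^sup>2 mod p) ?A" using card_image_le[of ?A "\<lambda>y. y\<^sup>2 mod p"] by (intro eq_card_imp_inj_on) auto
  moreover have "(p - 1)\<^sup>2 mod p = 1\<^sup>2 mod p"
  proof -
    have "(p - 1)\<^sup>2 - 1\<^sup>2 = p * (p - 2)" by (simp add: power2_eq_square algebra_simps)
    then show ?thesis by (metis dvd_triv_left mod_eq_dvd_iff)
  qed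
  ultimately have "p - 1 = 1" by (rule inj_onD) (use assms in auto)
  then show False using assms by simp
qed

section \<open>Repunits and the Jacobi symbol\<close>

text \<open>The base is an arbitrary integer: with base \<open>- x\<close> and odd \<open>n\<close> this is \<open>(x^n + 1) / (x + 1)\<close>.\<close>
definition repunit :: "int \<Rightarrow> nat \<Rightarrow> int" where
  "repunit y n = (\<Sum>i<n. y ^ i)"

lemma repunit_0 [simp]: "repunit y 0 = 0"
  and repunit_Suc: "repunit y (Suc n) = repunit y n + y ^ n"
  by (simp_all add: repunit_def)

lemma repunit_mult: "(y - 1) * repunit y n = y ^ n - 1"
  by (induction n) (simp_all add: repunit_Suc algebra_simps)

lemma repunit_add: "repunit y (a + b) = repunit y a + y ^ a * repunit y b"
  by (induction b) (simp_all add: repunit_Suc algebra_simps power_add)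

lemma repunit_cong_1:
  assumes "n > 0" shows "y dvd repunit y n - 1"
proof -
  obtain k where "n = 1 + k" using assms by (metis Suc_eq_plus1_left Suc_pred')
  then show ?thesis using repunit_add[of y 1 k] by (simp add: repunit_Suc)
qed

lemma repunit_cong: "y - 1 dvd repunit y n - int n"
proof (induction n)
  case (Suc n)
  have "y - 1 dvd y ^ n - 1" using repunit_mult[of y n] by (metis dvd_triv_left)
  from dvd_add[OF Suc this] show ?case by (simp add: repunit_Suc algebra_simps)
qed simp

lemma repunit_odd_mod_4:
  assumes "y mod 4 = 3" "odd n"
  shows "repunit y n mod 4 = 1"
proof -
  have "repunit y (2 * k + 1) mod 4 = 1" for k
  proof (induction k)
    case (Suc k)
    have "4 dvd y + 1" using assms(1) by presburger
    then obtain t where "repunit y (2 * Suc k + 1) = repunit y (2 * k + 1) + 4 * t"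
    proof -
      have "repunit y (2 * Suc k + 1) = repunit y (2 * k + 1) + y ^ (2 * k + 1) * (y + 1)"
        by (simp add: repunit_Suc algebra_simps)
      moreover from \<open>4 dvd y + 1\<close> obtain u where "y + 1 = 4 * u" by (elim dvdE)
      ultimately have "repunit y (2 * Suc k + 1) = repunit y (2 * k + 1) + 4 * (y ^ (2 * k + 1) * u)"
        by simp
      then show thesis by (rule that)
    qed
    then show ?case using Suc by simp
  qed (simp add: repunit_Suc)
  then show ?thesis using assms(2) by (metis oddE)
qed

lemma repunit_odd_pos:
  assumes "y < 0" "odd n"
  shows "repunit y n > 0"
proof -
  have "y ^ n < 0" using assms by (simp add: power_less_zero_eq)
  then have "(y - 1) * repunit y n < 0" unfolding repunit_mult by linarith
  then show ?thesis using assms(1) by (simp add: mult_less_0_iff)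
qed

text \<open>
  The Euclidean algorithm on the exponents \<open>n\<close> and \<open>k\<close>, with \<open>n\<close> replaced by \<open>\<bar>n - 2 k\<bar>\<close> so that both
  stay odd. Modulo \<open>repunit y k\<close> this changes \<open>repunit y n\<close> at most by a factor \<open>-1\<close> and a power of
  \<open>y\<close>. Since \<open>repunit y k\<close> is 1 modulo 4 and modulo \<open>y\<close>, both factors have symbol 1, and the
  arguments can be exchanged without a sign.
\<close>
lemma jacobi_repunit:
  assumes y: "y mod 4 = 3" "y < 0" and "odd k" "odd n" "coprime k n"
  shows "jacobi (repunit y n) (repunit y k) = 1"
  using assms(3-5)
proof (induction "k + n" arbitrary: k n rule: less_induct)
  case less
  let ?Q = "repunit y"
  have pos: "?Q m > 0" "?Q m mod 4 = 1" "odd (?Q m)" if "odd m" for m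
  proof -
    show "?Q m > 0" "?Q m mod 4 = 1" using that y repunit_odd_pos repunit_odd_mod_4 by blast+
    then show "odd (?Q m)" by presburger
  qed
  have main: "jacobi (?Q n) (?Q k) = 1" if n: "k < n" "odd k" "odd n" "coprime k n"
    and IH: "\<And>r. r < n \<Longrightarrow> odd r \<Longrightarrow> coprime k r \<Longrightarrow> jacobi (?Q r) (?Q k) = 1" for k n
  proof -
    have Q2k: "?Q k dvd ?Q (k + k)" by (simp add: repunit_add)
    show ?thesis
    proof (cases "n > 2 * k")
      case True
      define r where "r = n - 2 * k"
      have r: "n = (k + k) + r" using True by (simp add: r_def)
      have "coprime k r"
      proof (rule coprimeI)
        fix d assume d: "d dvd k" "d dvd r"
        then have "d dvd n" unfolding r by simp
        then show "is_unit d" using d n(4) coprime_common_divisor by blast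
      qed
      moreover have "odd r" "r < n" using n r by (auto intro: Nat.gr0I)
      ultimately have "jacobi (?Q r) (?Q k) = 1" using IH by blast
      moreover have "[?Q n = ?Q r] (mod ?Q k)"
      proof -
        have "?Q n - ?Q r = ?Q (k + k) + (y ^ (k + k) - 1) * ?Q r"
          unfolding r repunit_add[of y "k + k"] by (simp add: algebra_simps)
        also have "\<dots> = ?Q (k + k) * (1 + (y - 1) * ?Q r)"
          unfolding repunit_mult[symmetric] by (simp only: algebra_simps mult_1_right)
        finally show ?thesis using Q2k by (simp add: cong_iff_dvd_diff)
      qed
      ultimately show ?thesis using jacobi_cong by simp
    next
      case False
      define r where "r = 2 * k - n"
      have r: "k + k = r + n" using False by (simp add: r_def)
      have "coprime k r"
      proof (rule coprimeI)
        fix d assume d: "d dvd k" "d dvd r"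
        then have "d dvd r + n" unfolding r[symmetric] by simp
        then have "d dvd n" using d by (simp add: dvd_add_right_iff)
        then show "is_unit d" using d n(4) coprime_common_divisor by blast
      qed
      moreover have "odd r" using n r by presburger
      moreover have "r < n" using n r by linarith
      ultimately have Jr: "jacobi (?Q r) (?Q k) = 1" using IH by blast
      have "[y ^ r * ?Q n = (-1) * ?Q r] (mod ?Q k)"
        using Q2k unfolding r repunit_add by (simp add: cong_iff_dvd_diff add.commute)
      then have "jacobi (y ^ r * ?Q n) (?Q k) = jacobi ((-1) * ?Q r) (?Q k)" by (rule jacobi_cong)
      then have "jacobi (y ^ r) (?Q k) * jacobi (?Q n) (?Q k) = jacobi (-1) (?Q k) * jacobi (?Q r) (?Q k)"
        by (simp only: jacobi_mult_left[OF pos(3)[OF n(2)] pos(1)[OF n(2)]])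
      then have "jacobi (y ^ r) (?Q k) * jacobi (?Q n) (?Q k) = 1"
        using pos[OF n(2)] Jr jacobi_minus_1 by simp
      moreover have "jacobi y (?Q k) = 1"
      proof -
        have "odd (- y)" using y by presburger
        then have "jacobi (- y) (?Q k) = jacobi (?Q k) (- y)"
          using y pos[OF n(2)] by (intro jacobi_reciprocity_1_mod_4) auto
        also have "\<dots> = jacobi 1 (- y)"
          using repunit_cong_1[of k y] n(2) by (intro jacobi_cong) (auto simp: cong_iff_dvd_diff intro: Nat.gr0I)
        also have "\<dots> = 1" using y \<open>odd (- y)\<close> by (intro jacobi_1_left) auto
        finally have "jacobi ((-1) * (- y)) (?Q k) = 1"
          unfolding jacobi_mult_left[OF pos(3)[OF n(2)] pos(1)[OF n(2)]]
          using pos[OF n(2)] jacobi_minus_1 by simp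
        then show ?thesis by simp
      qed
      ultimately show ?thesis using pos[OF n(2)] by (simp add: jacobi_power_left)
    qed
  qed
  consider "k = n" | "k < n" | "n < k" by linarith
  then show ?case
  proof cases
    case 1
    then have "k = 1" using less.prems by simp
    then show ?thesis by (simp add: repunit_Suc)
  next
    case 2
    show ?thesis
    proof (rule main[OF 2 less.prems])
      fix r assume "r < n" "odd r" "coprime k r"
      then show "jacobi (?Q r) (?Q k) = 1" using less.hyps[of k r] less.prems(1) by simp
    qed
  next
    case 3
    have "coprime n k" using less.prems(3) by (simp add: coprime_commute)
    have "jacobi (?Q k) (?Q n) = 1"
    proof (rule main[OF 3 less.prems(2,1) \<open>coprime n k\<close>])
      fix r assume "r < k" "odd r" "coprime n r"
      then show "jacobi (?Q r) (?Q n) = 1" using less.hyps[of n r] less.prems(2) by simp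
    qed
    then show ?thesis using jacobi_reciprocity_1_mod_4[of "?Q n" "?Q k"] pos less.prems by simp
  qed
qed

text \<open>
  Let \<open>Q\<close> be the repunit with \<open>k\<close> digits, \<open>k\<close> odd and prime to \<open>p\<close>. If \<open>repunit y p = p v\<^sup>2\<close>, then
  \<open>1 = (p v\<^sup>2 / Q) = (p / Q) = (Q / p)\<close>, and \<open>Q \<equiv> k (mod p)\<close> because \<open>y \<equiv> 1 (mod p)\<close>. So \<open>k\<close> is a
  quadratic residue modulo \<open>p\<close>, whereas it can be chosen to be a nonresidue.
\<close>
lemma repunit_not_prime_times_square:
  fixes p :: nat
  assumes y: "y mod 4 = 3" "y < 0" and p: "prime p" "odd p" "int p dvd y - 1"
  shows "repunit y p \<noteq> int p * v\<^sup>2"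
proof
  assume eq: "repunit y p = int p * v\<^sup>2"
  have p2: "prime (int p)" "int p > 2" using p prime_ge_2_nat[of p] by (auto simp: order_less_le)
  obtain a where a: "a > 0" "Legendre a (int p) = -1" using quadratic_nonresidue_exists[OF p2] by blast
  have nd: "\<not> int p dvd a" using a(2) by (auto simp: Legendre_def cong_0_iff)
  \<comment> \<open>Adding the odd prime \<open>p\<close>, if necessary, makes the nonresidue odd.\<close>
  define k where "k = nat (if odd a then a else a + int p)"
  have k: "int k = (if odd a then a else a + int p)" using a(1) by (simp add: k_def)
  have "odd (int k)" using k p(2) by (auto split: if_splits)
  then have ok: "odd k" by simp
  have cong_k: "[int k = a] (mod int p)" unfolding k by (simp add: cong_def)
  then have "\<not> int p dvd int k" using nd cong_dvd_iff by blast
  then have "\<not> p dvd k" by simp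
  then have cop: "coprime k p" using p(1) prime_imp_coprime coprime_commute by blast
  let ?Q = "repunit y k"
  have Q: "?Q > 0" "?Q mod 4 = 1" using y ok repunit_odd_pos repunit_odd_mod_4 by blast+
  then have oQ: "odd ?Q" by presburger
  have "1 = jacobi (int p * v\<^sup>2) ?Q" using jacobi_repunit[OF y ok p(2) cop] eq by simp
  also have "\<dots> = jacobi (int p) ?Q * (jacobi v ?Q)\<^sup>2"
    using Q oQ by (simp add: jacobi_mult_left jacobi_power_left)
  finally have "jacobi (int p) ?Q = 1" 
    using zmult_eq_1_iff[of "jacobi (int p) ?Q" "(jacobi v ?Q)\<^sup>2"] by (smt (verit) zero_le_power2)
  moreover have "jacobi (int p) ?Q = jacobi ?Q (int p)"
    using Q p p2 by (intro jacobi_reciprocity_1_mod_4) auto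
  moreover have "\<dots> = jacobi a (int p)"
  proof (rule jacobi_cong)
    have "[?Q = int k] (mod int p)" using p(3) repunit_cong[of y k] by (simp add: cong_iff_dvd_diff dvd_trans)
    then show "[?Q = a] (mod int p)" using cong_k cong_trans by blast
  qed
  ultimately show False using a(2) p2 by (simp add: jacobi_prime)
qed

section \<open>Exponents with \<open>q^k + 1\<close> twice a square\<close>

lemma power_mod_4_of_1_mod_4:
  fixes q :: int
  assumes "q mod 4 = 1"
  shows "q ^ k mod 4 = 1" "(q ^ k + 1) mod 4 = 2"
proof -
  have "q ^ k mod 4 = (q mod 4) ^ k mod 4" by (simp add: power_mod)
  then show "q ^ k mod 4 = 1" using assms by simp
  then show "(q ^ k + 1) mod 4 = 2" by presburger
qed

text \<open>
  Put \<open>x = q^j\<close>, \<open>A = (x + 1) / 2\<close> and \<open>W = (x^p + 1) / (x + 1)\<close>, so that \<open>A W = c\<^sup>2\<close>. As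
  \<open>W \<equiv> p (mod A)\<close>, the common divisors of \<open>A\<close> and \<open>W\<close> divide \<open>p\<close>. If \<open>A\<close> and \<open>W\<close> are coprime, then
  \<open>W\<close> is a square and the Pell-type equation applies with \<open>y = - x\<close>; otherwise \<open>W\<close> is \<open>p\<close> times a
  square, against the Jacobi symbol computation, which uses \<open>x \<equiv> 1 (mod 4)\<close>.
\<close>
lemma odd_prime_exponent_plus_one_not_twice_square:
  fixes q c :: int and p :: nat
  assumes q: "prime q" "q mod 4 = 1" and j: "j > 0" and p: "prime p" "odd p"
  shows "(q ^ j) ^ p + 1 \<noteq> 2 * c\<^sup>2"
proof
  assume eq: "(q ^ j) ^ p + 1 = 2 * c\<^sup>2"
  define x where "x = q ^ j"
  define W where "W = repunit (- x) p"
  have q5: "q \<ge> 5" using q prime_ge_2_int[of q] by presburger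
  have x0: "x > 0" using q5 by (simp add: x_def)
  have x4: "x mod 4 = 1" unfolding x_def by (rule power_mod_4_of_1_mod_4[OF q(2)])
  then have "even (x + 1)" by presburger
  then obtain A where A: "x + 1 = 2 * A" by (elim evenE)
  have A0: "A > 0" using A x0 by simp
  have xp: "(x + 1) * W = x ^ p + 1"
    using repunit_mult[of "- x" p] p(2) unfolding W_def by (simp add: algebra_simps)
  then have AW: "A * W = c\<^sup>2" using eq A by (simp add: x_def)
  have W0: "W > 0" unfolding W_def using x0 p(2) by (intro repunit_odd_pos) auto
  have AWp: "A dvd W - int p"
  proof -
    have "- x - 1 dvd W - int p" unfolding W_def by (rule repunit_cong)
    moreover have "- x - 1 = A * (-2)" using A by simp
    then have "A dvd - x - 1" by simp
    ultimately show ?thesis by (rule dvd_trans[rotated])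
  qed
  show False
  proof (cases "int p dvd A")
    case False
    have "coprime A W"
    proof (rule coprimeI)
      fix d assume d: "d dvd A" "d dvd W"
      have "d dvd W - int p" using d(1) AWp by (rule dvd_trans)
      with d(2) have "d dvd W - (W - int p)" by (rule dvd_diff)
      then have "d dvd int p" by simp
      moreover have "coprime A (int p)"
        using False p(1) prime_imp_coprime[of "int p" A] by (simp add: coprime_commute)
      ultimately show "is_unit d" using d(1) coprime_common_divisor by blast
    qed
    then obtain v where v: "W = v\<^sup>2"
      using coprime_mult_square[of W A c] AW W0 A0 by (auto simp: coprime_commute mult.commute)
    obtain h where h: "p = 2 * h + 1" using p(2) by (rule oddE)
    have "h > 0" using h p(1) by (auto intro: Nat.gr0I)
    have "x * (q ^ (j * h))\<^sup>2 = x ^ p"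
    proof -
      have "q ^ (j * h) = x ^ h" by (simp add: x_def power_mult)
      moreover have "x ^ p = x * (x ^ h)\<^sup>2" unfolding h by (simp add: power_mult[symmetric] mult.commute)
      ultimately show ?thesis by simp
    qed
    then have "(- x) * (q ^ (j * h))\<^sup>2 - (- x - 1) * v\<^sup>2 = 1"
      using xp v by (simp add: algebra_simps)
    then show False
      using pell_prime_power[OF q(1) q5, of "- x" j "q ^ (j * h)" "j * h" v] x0 j \<open>h > 0\<close> by (simp add: x_def)
  next
    case True
    then obtain A' where A': "A = int p * A'" by (elim dvdE)
    have "int p dvd W - int p" using True AWp by (rule dvd_trans)
    then have "int p dvd (W - int p) + int p" by (intro dvd_add) auto
    then obtain B where B: "W = int p * B" by (auto elim: dvdE)
    have p0: "int p > 0" using p(1) prime_gt_0_nat by simp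
    have "int p dvd c\<^sup>2" using AW[symmetric] A' by simp
    then have "int p dvd c" using p(1) prime_dvd_power[of "int p" c 2] by simp
    then obtain c' where c': "c = int p * c'" by (elim dvdE)
    have "int p * int p * (A' * B) = int p * int p * c'\<^sup>2" using AW unfolding A' B c' by (simp add: power2_eq_square algebra_simps)
    then have AB: "A' * B = c'\<^sup>2" using p0 by simp
    have "coprime A' B"
    proof (rule coprimeI)
      fix d assume d: "d dvd A'" "d dvd B"
      have dW: "int p * d dvd W" and dA: "int p * d dvd A" using d unfolding A' B by simp_all
      have "int p * d dvd W - int p" using dA AWp by (rule dvd_trans)
      with dW have "int p * d dvd W - (W - int p)" by (rule dvd_diff)
      then have "int p * d dvd int p * 1" by simp
      then show "is_unit d" using p0 by (simp only: dvd_mult_cancel_left) simp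
    qed
    moreover have "A' > 0" "B > 0" using A0 W0 p0 unfolding A' B by (simp_all add: zero_less_mult_iff)
    ultimately obtain v where v: "B = v\<^sup>2"
      using coprime_mult_square[of B A' c'] AB by (auto simp: coprime_commute mult.commute)
    have "(- x) mod 4 = 3" using x4 by presburger
    moreover have "int p dvd - x - 1"
    proof -
      have "- x - 1 = A * (-2)" using A by simp
      then show ?thesis using True by simp
    qed
    ultimately have "W \<noteq> int p * v\<^sup>2"
      unfolding W_def using x0 p by (intro repunit_not_prime_times_square) auto
    then show False using B v by simp
  qed
qed

text \<open>An exponent above 2 is divisible by 4 or by an odd prime.\<close>
lemma prime_power_plus_one_twice_square:
  fixes q c :: int
  assumes q: "prime q" "q mod 4 = 1" and eq: "q ^ k + 1 = 2 * c\<^sup>2"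
  shows "k \<le> 2"
proof (rule ccontr)
  assume "\<not> k \<le> 2"
  then have k: "k > 2" by simp
  show False
  proof (cases "4 dvd k")
    case True
    then obtain j where j: "k = j * 4" by (auto elim: dvdE)
    have "(q ^ j) ^ 4 + 1 = 2 * c\<^sup>2" using eq unfolding j power_mult .
    moreover have "q ^ j > 1" using k j prime_gt_1_int[OF q(1)] by (intro one_less_power) auto
    ultimately show False by (rule fourth_plus_one_not_twice_square)
  next
    case False
    obtain p where p: "prime p" "odd p" "p dvd k"
    proof -
      define m where "m = (if odd k then k else k div 2)"
      have "odd m"
      proof (cases "odd k")
        case True
        then show ?thesis by (simp add: m_def)
      next
        case False
        then have "m = k div 2" by (simp add: m_def)
        then show ?thesis using False \<open>\<not> 4 dvd k\<close> by presburger
      qed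
      have "m dvd k" unfolding m_def by (auto elim: evenE)
      have "m \<noteq> 1" using k unfolding m_def by (auto split: if_splits elim: evenE)
      then obtain p where "prime p" "p dvd m" using prime_factor_nat by blast
      then show thesis using that \<open>odd m\<close> \<open>m dvd k\<close> dvd_trans by blast
    qed
    from p(3) obtain j where j: "k = j * p" by (metis dvdE mult.commute)
    have "j > 0" using j k by (auto intro: Nat.gr0I)
    then show False
      using odd_prime_exponent_plus_one_not_twice_square[OF q _ p(1,2), of j c] eq by (simp add: j power_mult)
  qed
qed

section \<open>Repunits that are squares\<close>

lemma coprime_repunit:
  fixes q :: int
  assumes "q ^ m + 1 = 2 * h" "odd h"
  shows "coprime (repunit q m) h"
proof (rule coprimeI)
  fix d assume d: "d dvd repunit q m" "d dvd h"
  have "2 * h - (q - 1) * repunit q m = 2" using assms(1) repunit_mult[of q m] by simp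
  moreover have "d dvd 2 * h - (q - 1) * repunit q m" using d by (intro dvd_diff dvd_mult)
  ultimately have "d dvd 2" by simp
  moreover have "odd d" using d(2) assms(2) dvd_trans by blast
  ultimately show "is_unit d" by (metis coprime_common_divisor coprime_right_2_iff_odd dvd_refl)
qed

lemma half_prime_power_plus_one:
  fixes q :: int
  assumes "q mod 4 = 1" "q > 0"
  obtains h where "q ^ k + 1 = 2 * h" "odd h" "h > 0"
proof -
  have m: "(q ^ k + 1) mod 4 = 2" by (rule power_mod_4_of_1_mod_4[OF assms(1)])
  define h where "h = (q ^ k + 1) div 2"
  have "q ^ k + 1 = 2 * h" "odd h" using m unfolding h_def by presburger+
  moreover have "q ^ k > 0" using assms by simp
  ultimately show thesis using that by auto
qed

lemma repunit_pos: "q > 0 \<Longrightarrow> n > 0 \<Longrightarrow> repunit q n > 0"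
  unfolding repunit_def by (intro sum_pos) auto

text \<open>
  For odd \<open>m\<close> the equation \<open>q^m - 1 = (q - 1) a\<^sup>2\<close> is of the Pell type excluded above, with \<open>X\<close> a power
  of \<open>q\<close>. For \<open>m = 2 k\<close> the factorization \<open>R k * (q^k + 1)\<close> makes \<open>(q^k + 1) / 2\<close> a square, which
  leaves only \<open>k \<le> 2\<close>; parity excludes \<open>k = 1\<close>.
\<close>
lemma repunit_not_square:
  fixes q a :: int
  assumes q: "prime q" "q mod 4 = 1" and m: "m > 1"
  shows "repunit q m \<noteq> a\<^sup>2"
proof
  assume eq: "repunit q m = a\<^sup>2"
  have q5: "q \<ge> 5" using q prime_ge_2_int[of q] by presburger
  have parity: "even (repunit q n) \<longleftrightarrow> even n" for n
  proof -
    have "even (q - 1)" using q(2) by presburger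
    then have "even (repunit q n - int n)" using repunit_cong[of q n] dvd_trans by blast
    then show ?thesis by simp
  qed
  show False
  proof (cases "even m")
    case False
    then obtain s where s: "m = 2 * s + 1" by (rule oddE)
    have "q * (q ^ s)\<^sup>2 = q ^ m" unfolding s by (simp add: power_mult[symmetric] mult.commute)
    then have "q * (q ^ s)\<^sup>2 - (q - 1) * a\<^sup>2 = 1" using repunit_mult[of q m] eq by simp
    then show False using pell_prime_power[OF q(1) q5, of q 1 "q ^ s" s a] q5 m s by simp
  next
    case True
    then obtain k where k: "m = k + k" by (metis evenE mult_2)
    have k0: "k > 0" using k m by simp
    obtain h where h: "q ^ k + 1 = 2 * h" "odd h" "h > 0"
      using half_prime_power_plus_one[OF q(2)] q5 by auto
    have a2: "repunit q k * (2 * h) = a\<^sup>2" using eq unfolding k repunit_add h(1)[symmetric] by (simp add: algebra_simps)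
    have R0: "repunit q k > 0" using q5 k0 by (intro repunit_pos) auto
    have "even a" using a2 by (metis dvd_triv_left even_mult_iff even_power)
    then obtain b where b: "a = 2 * b" by (elim evenE)
    have b2: "repunit q k * h = 2 * b\<^sup>2" using a2 unfolding b by (simp add: power_mult_distrib mult_ac)
    have "even (repunit q k)" using b2 h(2) by (metis dvd_triv_left even_mult_iff)
    have "coprime h (2 * repunit q k)"
      using coprime_repunit[OF h(1,2)] h(2) by (simp add: coprime_commute)
    moreover have "h * (2 * repunit q k) = a\<^sup>2" using a2 by (simp add: mult_ac)
    ultimately obtain c where c: "c > 0" "h = c\<^sup>2" using coprime_mult_square[of h "2 * repunit q k" a] R0 h(3) by auto
    have "k \<le> 2" using prime_power_plus_one_twice_square[OF q, of k c] h(1) c by simp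
    moreover have "even k" using \<open>even (repunit q k)\<close> parity by simp
    ultimately have k2: "k = 2" using k0 by (auto elim!: evenE)
    then have "repunit q k = q + 1" by (simp add: repunit_def numeral_2_eq_2)
    then have "coprime (2 * (q + 1)) h" "2 * (q + 1) * h = a\<^sup>2"
      using \<open>coprime h (2 * repunit q k)\<close> a2 by (simp_all add: coprime_commute mult_ac)
    \<comment> \<open>In the remaining case \<open>k = 2\<close> both \<open>q + 1 = 2 d\<^sup>2\<close> and \<open>q\<^sup>2 + 1 = 2 c\<^sup>2\<close>. Their
      difference is \<open>q (q - 1) = 2 (c - d) (c + d)\<close>, so the size of \<open>c\<close> and \<open>d\<close> forces \<open>c + d = q\<close>
      and then \<open>q = 4 d - 1\<close>, against \<open>q \<equiv> 1 (mod 4)\<close>.\<close>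
    then obtain d0 where d0: "d0 > 0" "2 * (q + 1) = d0\<^sup>2" using coprime_mult_square[of "2 * (q + 1)" h a] q5 h(3) by auto
    then have "even d0" by (metis dvd_triv_left even_power)
    then obtain d where d: "d0 = 2 * d" by (elim evenE)
    have d2: "q + 1 = 2 * d\<^sup>2" using d0(2) unfolding d by (simp add: power_mult_distrib)
    have dpos: "d > 0" using d0(1) d by simp
    have c2: "q\<^sup>2 + 1 = 2 * c\<^sup>2" using h(1) c(2) k2 by simp
    have "c\<^sup>2 < q\<^sup>2" using c2 q5 by (smt (verit) one_less_power pos2)
    then have cq: "c < q" by (rule power2_less_imp_less) (use q5 in simp)
    have "q < q\<^sup>2" using q5 by (simp add: power2_eq_square)
    then have "d\<^sup>2 < c\<^sup>2" using c2 d2 by linarith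
    then have dc: "d < c" by (rule power2_less_imp_less) (use c in simp)
    have fac: "q * (q - 1) = 2 * ((c - d) * (c + d))" using c2 d2 by (simp add: power2_eq_square algebra_simps)
    have "\<not> q dvd 2" using q5 zdvd_not_zless[of 2 q] by auto
    moreover have "q dvd 2 * ((c - d) * (c + d))" using fac by (metis dvd_triv_left)
    ultimately have "q dvd c - d \<or> q dvd c + d" using q(1) by (simp add: prime_dvd_mult_iff)
    moreover have "\<not> q dvd c - d" using cq dc dpos by (intro zdvd_not_zless) auto
    ultimately obtain t where t: "c + d = q * t" by (auto elim: dvdE)
    have "q * t < q * 2" "q * 0 < q * t" unfolding t[symmetric] using cq dc dpos by linarith+
    then have "t < 2" "0 < t" using q5 by (simp_all only: mult_less_cancel_left_pos)
    then have "t = 1" by simp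
    then have cd: "c + d = q" using t by simp
    have "q * (q - 1) = q * (2 * (c - d))" using fac unfolding cd by (simp add: mult_ac)
    then have "q - 1 = 2 * (c - d)" using q5 by simp
    then have "q = 4 * d - 1" unfolding cd[symmetric] by simp
    then show False using q(2) by presburger
  qed
qed

section \<open>The equation \<open>\<sigma>(q^\<alpha>) = 2 l n\<^sup>2\<close>\<close>

theorem theorem2p2:
  shows "\<not> (\<exists>\<alpha> n q l :: int.
            \<alpha> > 3 \<and> prime q \<and> [q = 1] (mod 4) \<and> prime l \<and>
            2 * l * n ^ 2 = sigma (q ^ nat \<alpha>))"
proof (intro notI, elim exE conjE)
  fix \<alpha> n q l :: int
  assume \<alpha>: "\<alpha> > 3" and q: "prime q" "[q = 1] (mod 4)" and l: "prime l"
    and eq: "2 * l * n ^ 2 = sigma (q ^ nat \<alpha>)"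
  have q4: "q mod 4 = 1" using q(2) by (simp add: cong_def)
  have q0: "q > 0" using q(1) by (rule prime_gt_0_int)
  define N where "N = Suc (nat \<alpha>)"
  have eq': "2 * l * n\<^sup>2 = repunit q N"
    using eq sigma_prime_power[OF q(1)] by (simp add: repunit_def N_def lessThan_Suc_atMost)
  have "even (q - 1)" using q4 by presburger
  then have "even (repunit q N - int N)" using repunit_cong[of q N] dvd_trans by blast
  moreover have "even (repunit q N)" unfolding eq'[symmetric] by simp
  ultimately have "even N" by simp
  then obtain m where m: "N = m + m" by (metis evenE mult_2)
  have m3: "m \<ge> 3" using m \<alpha> unfolding N_def by linarith
  obtain h where h: "q ^ m + 1 = 2 * h" "odd h" "h > 0"
    using half_prime_power_plus_one[OF q4 q0] by blast
  define R where "R = repunit q m"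
  have R0: "R > 0" unfolding R_def using q0 m3 by (intro repunit_pos) auto
  have cop: "coprime R h" unfolding R_def by (rule coprime_repunit[OF h(1,2)])
  have "2 * l * n\<^sup>2 = R * (q ^ m + 1)" unfolding eq' m repunit_add R_def by (simp add: algebra_simps)
  then have Rh: "R * h = l * n\<^sup>2" unfolding h(1) by simp
  have l0: "l > 0" using l by (rule prime_gt_0_int)
  have "l dvd R * h" unfolding Rh by simp
  then consider "l dvd R" | "l dvd h" using l prime_dvd_mult_iff by blast
  then show False
  proof cases
    case 1
    then obtain R' where R': "R = l * R'" by (elim dvdE)
    have "coprime h R'" "h * R' = n\<^sup>2" "R' > 0"
      using cop Rh R0 l0 unfolding R' by (auto simp: coprime_commute mult_ac zero_less_mult_iff)
    then obtain d where "h = d\<^sup>2" using coprime_mult_square h(3) by blast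
    then have "m \<le> 2" using prime_power_plus_one_twice_square[OF q(1) q4] h(1) by blast
    then show False using m3 by simp
  next
    case 2
    then obtain h' where h': "h = l * h'" by (elim dvdE)
    have "coprime R h'" "R * h' = n\<^sup>2" "h' > 0"
      using cop Rh h(3) l0 unfolding h' by (auto simp: mult_ac zero_less_mult_iff)
    then obtain d where "R = d\<^sup>2" using coprime_mult_square R0 by blast
    then show False using repunit_not_square[OF q(1) q4, of m] m3 unfolding R_def by simp
  qed
qed

end
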